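(* Let $W$ be a non-negative integer valued random variable with $\mathbb{E}W=\mu$, $0<\mu<\infty$. Let $r>0$, and let $W^{*_r}$ be a random variable defined on the same probability space as $W$ and having the $r$-equilibrium distribution of $W$. Set $p=r/(r+\mu)$ and $c_{r,p}=\min\{(r+2)(1-p),\,2-p\}\le 2$. Then for any event $B$, $$d_{\mathrm{TV}}(\mathscr{L}(W),\mathrm{NB}(r,p))\le c_{r,p}\,\mathbb{E}\big[\mathbb{I}_B\,|W^{*_r}-W|\big]+2(e\max\{1,r\}+1)\,\mathbb{P}(B^c),$$ and moreover $$d_{\mathrm{TV}}(\mathscr{L}(W),\mathrm{NB}(r,p))\le 2(e\max\{1,r\}+1)\,\mathbb{P}(W^{*_r}\ne W).$$
   Context: For $r>0$, $0<p\le 1$, $X\sim\mathrm{NB}(r,p)$ means $\mathbb{P}(X=k)=\frac{\Gamma(r+k)}{k!\,\Gamma(r)}(1-p)^kp^r$, $k=0,1,\ldots$. $\mathscr{L}(X)$ is the law of $X$, $\mathbb{I}_B$ is the indicator of the event $B$, and for distributions of non-negative integer valued random variables $d_{\mathrm{TV}}(\mathscr{L}(X),\mathscr{L}(Y))=\sup_{A\subseteq\{0,1,\ldots\}}|\mathbb{P}(X\in A)-\mathbb{P}(Y\in A)|$. Pólya urn variables: for $r>0$ and integers $n\ge 1$, $U_{r,n}$ is the number of white balls drawn in $n-1$ draws from a standard Pólya urn started with $r$ "white balls" and $1$ black ball; that is, $U_{r,1}=0$ and for $k\ge 1$, $\mathbb{P}(U_{r,k+1}=U_{r,k}+1\mid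 U_{r,k})=1-\mathbb{P}(U_{r,k+1}=U_{r,k}\mid U_{r,k})=\frac{r+U_{r,k}}{r+k}$. Size bias: for a non-negative integer valued $X$ with finite (positive) mean, $X^s$ has the size bias distribution of $X$ if $\mathbb{P}(X^s=k)=k\,\mathbb{P}(X=k)/\mathbb{E}X$, $k=1,2,\ldots$. $r$-equilibrium: $X^{*_r}$ has the $r$-equilibrium distribution (transformation) of $X$ if $X^{*_r}$ is equal in distribution to $U_{r,X^s}$, where $\mathscr{L}(U_{r,X^s}\mid X^s=k)=\mathscr{L}(U_{r,k})$. *)

theory Defs
  imports "HOL-Probability.Probability"
begin

definition law :: "'a measure \<Rightarrow> ('a \<Rightarrow> nat) \<Rightarrow> nat pmf" where
  "law M X = Abs_pmf (distr M (count_space UNIV) X)"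

lemma measure_pmf_law:
  assumes "prob_space M" and X: "X \<in> measurable M (count_space UNIV)"
  shows "measure_pmf (law M X) = distr M (count_space UNIV) X"
proof -
  interpret prob_space M by fact
  interpret D: prob_space "distr M (count_space UNIV) X"
    by (rule prob_space_distr) (rule X)
  have "AE x in distr M (count_space UNIV) X. measure (distr M (count_space UNIV) X) {x} \<noteq> 0"
    by (rule iffD2 [OF D.AE_support_countable]) (simp, rule exI[of _ UNIV], simp)
  then show ?thesis
    unfolding law_def by (subst Abs_pmf_inverse) (auto intro: D.prob_space_axioms)
qed

definition total_variation :: "nat pmf \<Rightarrow> nat pmf \<Rightarrow> real" where
  "total_variation P Q = (SUP A. \<bar>measure_pmf.prob P A - measure_pmf.prob Q A\<bar>)"

text \<open>The library's \<open>neg_binomial_pmf\<close> only allows natural \<open>r\<close>.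
  The weights below form a probability mass function for \<open>r > 0\<close> and \<open>0 < p \<le> 1\<close>, see
  \<open>pmf_NB\<close>; outside that range \<open>NB r p\<close> is unspecified.\<close>

definition NB :: "real \<Rightarrow> real \<Rightarrow> nat pmf" where
  "NB r p = embed_pmf (\<lambda>k. Gamma (r + real k) / (fact k * Gamma r) * (1 - p) ^ k * p powr r)"

lemma pmf_NB:
  assumes r: "r > 0" and p: "0 < p" "p \<le> 1"
  shows "pmf (NB r p) k = Gamma (r + real k) / (fact k * Gamma r) * (1 - p) ^ k * p powr r"
proof -
  let ?f = "\<lambda>k. Gamma (r + real k) / (fact k * Gamma r) * (1 - p) ^ k * p powr r"
  have nonneg: "?f k \<ge> 0" for k
    using assms Gamma_real_pos[of r] Gamma_real_pos[of "r + real k"] by auto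
  have G: "Gamma (r + real k) / (fact k * Gamma r) * (1 - p) ^ k
      = (- r gchoose k) * (p - 1) ^ k" for k
  proof -
    have "pochhammer r k = Gamma (r + real k) / Gamma r"
      using r by (intro pochhammer_Gamma) (auto elim!: nonpos_Ints_cases)
    moreover have "(1 - p) ^ k = (- 1) ^ k * (p - 1) ^ k"
      by (metis minus_diff_eq power_minus)
    ultimately show ?thesis
      by (simp add: gbinomial_pochhammer mult_ac)
  qed
  have "(\<lambda>k. (- r gchoose k) * (p - 1) ^ k) sums p powr (- r)"
    using gen_binomial_real [of "p - 1" "- r"] p by simp
  then have "(\<lambda>k. ?f k) sums (p powr (- r) * p powr r)"
    unfolding G by (rule sums_mult2)
  then have sums: "?f sums 1"
    using p by (simp flip: powr_add)
  have "(\<integral>\<^sup>+k. ennreal (?f k) \<partial>count_space UNIV) = (\<Sum>k. ennreal (?f k))"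
    by (rule nn_integral_count_space_nat)
  also have "\<dots> = ennreal 1"
    by (rule suminf_ennreal_eq [OF nonneg sums])
  finally have "(\<integral>\<^sup>+k. ennreal (?f k) \<partial>count_space UNIV) = 1"
    by simp
  then show ?thesis
    unfolding NB_def using nonneg by (intro pmf_embed_pmf) auto
qed

text \<open>Law of \<open>U\<^bsub>r,n\<^esub>\<close>, the number of white balls drawn in \<open>n - 1\<close> draws. Index \<open>n = 0\<close> has
  no meaning in the urn model; a size biased variable never takes that value.\<close>

primrec polya_urn :: "real \<Rightarrow> nat \<Rightarrow> nat pmf" where
  "polya_urn r 0 = return_pmf 0"
| "polya_urn r (Suc k) = (if k = 0 then return_pmf 0 else
     bind_pmf (polya_urn r k) (\<lambda>u.
       map_pmf (\<lambda>white. if white then u + 1 else u) (bernoulli_pmf ((r + real u) / (r + real k)))))"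

text \<open>Meaningful if the mean of \<open>P\<close> is finite and positive, see \<open>pmf_size_bias\<close>.\<close>

definition size_bias :: "nat pmf \<Rightarrow> nat pmf" where
  "size_bias P = embed_pmf (\<lambda>k. real k * pmf P k / measure_pmf.expectation P real)"

lemma pmf_size_bias:
  assumes int: "integrable (measure_pmf P) real" and pos: "measure_pmf.expectation P real > 0"
  shows "pmf (size_bias P) k = real k * pmf P k / measure_pmf.expectation P real"
proof -
  let ?m = "measure_pmf.expectation P real"
  have "(\<integral>\<^sup>+k. ennreal (real k * pmf P k / ?m) \<partial>count_space UNIV)
      = (\<integral>\<^sup>+k. ennreal (pmf P k) * ennreal (real k / ?m) \<partial>count_space UNIV)"
    using pos by (intro nn_integral_cong) (simp flip: ennreal_mult add: mult.commute)
  also have "\<dots> = (\<integral>\<^sup>+k. ennreal (real k / ?m) \<partial>measure_pmf P)"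
    by (simp add: nn_integral_measure_pmf)
  also have "\<dots> = ennreal (\<integral>k. real k / ?m \<partial>measure_pmf P)"
    using int pos by (intro nn_integral_eq_integral) auto
  also have "\<dots> = 1"
    using pos by simp
  finally show ?thesis
    unfolding size_bias_def using pos by (intro pmf_embed_pmf) auto
qed

definition equilibrium :: "real \<Rightarrow> nat pmf \<Rightarrow> nat pmf" where
  "equilibrium r P = bind_pmf (size_bias P) (polya_urn r)"

end

theory Submission
  imports Defs
begin

text \<open>
  Write \<open>\<pi>\<close> for \<open>NB r p\<close>, \<open>L k = \<pi> {..<k}\<close> and \<open>U k = \<pi> {k..}\<close>. The proof is Stein's method. For a set
  \<open>A\<close>, let \<open>f\<close> solve the negative binomial Stein equation
  \<open>(1 - p) (r + k) f (k + 1) - k f k = 1\<^sub>A k - \<pi> A\<close>. Splitting \<open>k f k\<close> as \<open>(1 - p) k f k + p k f k\<close> turns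
  the left side into \<open>g k - p k f k\<close> with \<open>g k = (1 - p) ((r + k) f (k + 1) - k f k)\<close>.

  The difference operator in \<open>g\<close> is adapted to the urn: on \<open>{..<n}\<close> the law of \<open>U\<^bsub>r,n\<^esub>\<close> has weights proportional to
  those of an \<open>NB r\<close> law with the geometric factor removed, so the expectation of
  \<open>(r + u) f (u + 1) - u f u\<close> telescopes to \<open>r f n\<close>. Averaging over a size biased \<open>n\<close> gives
  \<open>E g W\<^sup>* = p E (W f W)\<close> for the equilibrium variable \<open>W\<^sup>*\<close> of \<open>W\<close>, and with the Stein equation
  \<open>P (W \<in> A) - \<pi> A = E (g W - g W\<^sup>*)\<close>
  (\<open>equilibrium_identity\<close> and \<open>prob_diff_eq_flux_diff\<close>). The difference on the right vanishes where
  \<open>W = W\<^sup>*\<close>, and it remains to bound \<open>g\<close> and its increments, uniformly in \<open>A\<close>. In the formal text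
  \<open>k f k\<close> is \<open>stein A k\<close> and \<open>g\<close> is \<open>flux A\<close>.

  For the size of \<open>g\<close>: the explicit solution gives \<open>\<bar>k f k\<bar> \<le> L k * U k / \<pi> k\<close>. Since
  \<open>(j + 1) \<pi> (j + 1) - j \<pi> j = p (\<mu> - j) \<pi> j\<close> where \<open>\<mu> = r (1 - p) / p\<close> is the mean, \<open>k \<pi> k\<close> is the total
  of \<open>p (\<mu> - j) \<pi> j\<close> below \<open>k\<close>, and also that of \<open>p (j - \<mu>) \<pi> j\<close> from \<open>k\<close> on. Together these say
  that \<open>p L k U k / \<pi> k\<close> equals \<open>k\<close> divided by the gap between the means of \<open>\<pi>\<close> conditioned to
  \<open>{k..}\<close> and to \<open>{..<k}\<close>. That gap is at least \<open>k / (r + 1)\<close> (\<open>stein_kernel_bound\<close>), so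
  \<open>\<bar>g\<bar> \<le> r + 2 \<le> e max {1, r} + 1\<close>.

  For the increments: \<open>g (k + 1) - g k\<close> is linear in the indicator of \<open>A\<close>, and its coefficients can be
  computed (\<open>flux_diff\<close>). The coefficient of the point \<open>k + 1\<close> is nonnegative, those of \<open>k\<close> and of the points
  beyond \<open>k + 1\<close> are nonpositive, and the points below \<open>k\<close> have the sign of the increment of
  \<open>U k / \<pi> k\<close>, which decreases for \<open>r \<ge> 1\<close> and is controlled by a geometric tail for \<open>r < 1\<close>. Keeping the
  nonnegative coefficients bounds the increment from above; replacing \<open>A\<close> by its complement changes the
  sign of \<open>g\<close> and yields the bound from below.
\<close>

section \<open>The Polya urn\<close>

text \<open>The coefficient of \<open>x ^ u\<close> in \<open>(1 - x) powr (- r)\<close>. The partial sums over \<open>u \<le> n\<close> are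
  \<open>urn_weight (r + 1) n\<close>, which explains the normalisation in \<open>pmf_polya_urn\<close>.\<close>

definition urn_weight :: "real \<Rightarrow> nat \<Rightarrow> real" where
  "urn_weight r u = pochhammer r u / fact u"

lemma urn_weight_Suc: "real (Suc u) * urn_weight r (Suc u) = (r + real u) * urn_weight r u"
  by (simp add: urn_weight_def pochhammer_Suc mult.commute del: of_nat_Suc)

lemma urn_weight_pos: "r > 0 \<Longrightarrow> urn_weight r u > 0"
  by (simp add: urn_weight_def pochhammer_pos)

text \<open>One draw, sorted by its outcome. The support hypothesis keeps the parameter of the Bernoulli law
  inside the unit interval; it is a consequence of the closed form below, whose induction supplies it.\<close>

lemma pmf_polya_urn_Suc:
  assumes r: "r > 0" and n: "n > 0"
    and support: "\<And>u. n \<le> u \<Longrightarrow> pmf (polya_urn r n) u = 0"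
  shows "pmf (polya_urn r (Suc n)) m =
     (r + real m - 1) / (r + real n) * (if m = 0 then 0 else pmf (polya_urn r n) (m - 1))
     + (real n - real m) / (r + real n) * pmf (polya_urn r n) m"
proof -
  let ?P = "polya_urn r n"
  let ?step = "\<lambda>u. map_pmf (\<lambda>white. if white then u + 1 else u)
                 (bernoulli_pmf ((r + real u) / (r + real n)))"
  have step: "pmf (?step u) m = (if m = u + 1 then (r + real u) / (r + real n) else 0)
      + (if m = u then (real n - real u) / (r + real n) else 0)" if "u < n" for u
  proof -
    have b: "0 \<le> (r + real u) / (r + real n)" "(r + real u) / (r + real n) \<le> 1"
      using that r by auto
    have "pmf (?step u) m = measure_pmf.expectation (bernoulli_pmf ((r + real u) / (r + real n)))
        (\<lambda>x. indicator {m} (if x then u + 1 else u))"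
      by (simp add: map_pmf_def pmf_bind indicator_def)
    moreover have "1 - (r + real u) / (r + real n) = (real n - real u) / (r + real n)"
      using r that by (simp add: field_simps)
    ultimately show ?thesis
      using b by (auto simp: indicator_def)
  qed
  have supp: "set_pmf ?P \<subseteq> {..<n}"
    using support by (meson lessThan_iff not_le pmf_eq_0_set_pmf subsetI)
  have "pmf (polya_urn r (Suc n)) m = measure_pmf.expectation ?P (\<lambda>u. pmf (?step u) m)"
    using n by (simp add: pmf_bind)
  also have "\<dots> = (\<Sum>u<n. pmf (?step u) m * pmf ?P u)"
    by (rule integral_measure_pmf_real) (use supp in auto)
  also have "\<dots> = (\<Sum>u<n. (if m = u + 1 then (r + real u) / (r + real n) * pmf ?P u else 0)
      + (if m = u then (real n - real u) / (r + real n) * pmf ?P u else 0))"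
    by (intro sum.cong refl) (subst step; auto)
  also have "\<dots> = (\<Sum>u<n. if m = u + 1 then (r + real u) / (r + real n) * pmf ?P u else 0)
      + (real n - real m) / (r + real n) * pmf ?P m"
    using support[of m] by (auto simp: sum.distrib sum.delta)
  also have "(\<Sum>u<n. if m = u + 1 then (r + real u) / (r + real n) * pmf ?P u else 0)
      = (r + real m - 1) / (r + real n) * (if m = 0 then 0 else pmf ?P (m - 1))"
  proof (cases m)
    case (Suc m')
    have "(\<Sum>u<n. if m = u + 1 then (r + real u) / (r + real n) * pmf ?P u else 0)
       = (\<Sum>u<n. if m' = u then (r + real u) / (r + real n) * pmf ?P u else 0)"
      using Suc by (intro sum.cong) auto
    then show ?thesis
      using support[of m'] Suc by (auto simp: sum.delta)
  qed simp
  finally show ?thesis .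
qed

text \<open>A white draw contributes \<open>(r + u - 1) * urn_weight r (u - 1) = u * urn_weight r u\<close> and a black draw
  contributes \<open>(n - u) * urn_weight r u\<close>. Their sum \<open>n * urn_weight r u\<close> depends on \<open>u\<close> through the
  weight alone, so the shape is preserved.\<close>

lemma pmf_polya_urn:
  assumes r: "r > 0"
  shows "pmf (polya_urn r (Suc n)) u =
    (if u \<le> n then urn_weight r u / urn_weight (r + 1) n else 0)"
proof (induction n arbitrary: u)
  case 0
  then show ?case by (auto simp: urn_weight_def)
next
  case (Suc n)
  have n: "urn_weight (r + 1) (Suc n) = (r + 1 + real n) / (1 + real n) * urn_weight (r + 1) n"
    using urn_weight_Suc[of n "r + 1"] by (simp add: field_simps)
  have rec: "pmf (polya_urn r (Suc (Suc n))) u =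
     (r + real u - 1) / (r + real (Suc n)) * (if u = 0 then 0 else pmf (polya_urn r (Suc n)) (u - 1))
     + (real (Suc n) - real u) / (r + real (Suc n)) * pmf (polya_urn r (Suc n)) u"
    by (rule pmf_polya_urn_Suc[OF r]) (use Suc.IH in auto)
  have c: "urn_weight (r + 1) n > 0" using r by (simp add: urn_weight_pos)
  have u: "(if u = 0 then 0 else (r + real u - 1) * urn_weight r (u - 1)) = real u * urn_weight r u"
    using urn_weight_Suc[of "u - 1" r] by (cases u) (auto simp: algebra_simps)
  show ?case
  proof (cases "u \<le> Suc n")
    case True
    let ?w = "urn_weight r u" and ?c = "urn_weight (r + 1) n"
    have white: "(r + real u - 1) * (if u = 0 then 0 else pmf (polya_urn r (Suc n)) (u - 1))
        = real u * ?w / ?c"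
      using True u unfolding Suc.IH by (cases "u = 0") auto
    have black: "(real (Suc n) - real u) * pmf (polya_urn r (Suc n)) u
        = (real (Suc n) - real u) * ?w / ?c"
      using True unfolding Suc.IH by (cases "u = Suc n") auto
    have "pmf (polya_urn r (Suc (Suc n))) u
        = (real u * ?w / ?c + (real (Suc n) - real u) * ?w / ?c) / (r + real (Suc n))"
      unfolding rec add_divide_distrib by (simp only: white black times_divide_eq_left)
    also have "\<dots> = real (Suc n) * ?w / ?c / (r + real (Suc n))"
      by (simp flip: add_divide_distrib distrib_right del: of_nat_Suc)
    also have "\<dots> = ?w / urn_weight (r + 1) (Suc n)"
      unfolding n by (simp add: ac_simps)
    finally show ?thesis
      using True by simp
  next
    case False
    then show ?thesis unfolding rec Suc.IH by auto
  qed
qed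

text \<open>By \<open>(r + u) * urn_weight r u = (u + 1) * urn_weight r (u + 1)\<close> the terms of the expectation are
  differences of \<open>u * urn_weight r u * f u\<close>, and only the upper end \<open>u = n\<close> survives.\<close>

lemma polya_urn_telescope:
  assumes r: "r > 0" and n: "n > 0"
  shows "measure_pmf.expectation (polya_urn r n)
           (\<lambda>u. (r + real u) * f (Suc u) - real u * f u) = r * f n"
proof -
  obtain m where m: "n = Suc m" using n by (cases n) auto
  let ?w = "urn_weight r" and ?c = "urn_weight (r + 1) m"
  have c: "?c > 0" using r by (simp add: urn_weight_pos)
  have cw: "real n * ?w n = r * ?c"
    using pochhammer_rec[of r m]
    by (simp add: m urn_weight_def divide_simps del: of_nat_Suc)
  have "measure_pmf.expectation (polya_urn r n) (\<lambda>u. (r + real u) * f (Suc u) - real u * f u)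
      = (\<Sum>u<n. ((r + real u) * f (Suc u) - real u * f u) * pmf (polya_urn r n) u)"
    by (rule integral_measure_pmf_real)
      (auto simp: m pmf_polya_urn[OF r] set_pmf_iff simp del: polya_urn.simps split: if_splits)
  also have "\<dots> = (\<Sum>u<n. ((r + real u) * ?w u) * f (Suc u) - real u * ?w u * f u) / ?c"
    by (subst sum_divide_distrib, intro sum.cong refl)
      (auto simp: m pmf_polya_urn[OF r] diff_divide_distrib add_divide_distrib algebra_simps simp del: polya_urn.simps)
  also have "(\<Sum>u<n. ((r + real u) * ?w u) * f (Suc u) - real u * ?w u * f u)
      = (\<Sum>u<n. (real (Suc u) * ?w (Suc u) * f (Suc u) - real u * ?w u * f u))"
    by (simp only: urn_weight_Suc)
  also have "\<dots> = real n * ?w n * f n"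
    by (subst sum_lessThan_telescope) simp
  also have "\<dots> / ?c = r * f n"
    unfolding cw using c by simp
  finally show ?thesis .
qed

section \<open>The equilibrium transformation\<close>

lemma expectation_bind_pmf_bounded:
  fixes f :: "'b \<Rightarrow> real"
  assumes "\<And>x. \<bar>f x\<bar> \<le> C"
  shows "measure_pmf.expectation (bind_pmf P K) f
       = measure_pmf.expectation P (\<lambda>x. measure_pmf.expectation (K x) f)"
  unfolding measure_pmf_bind
  by (rule integral_bind[where K = "count_space UNIV" and B = C and B' = 1])
     (use assms in \<open>auto intro: measure_pmf.finite_measure measure_pmf_in_subprob_space\<close>)

lemma expectation_size_bias:
  fixes f :: "nat \<Rightarrow> real"
  assumes int: "integrable (measure_pmf P) real" and pos: "measure_pmf.expectation P real > 0"
  shows "measure_pmf.expectation (size_bias P) f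
       = measure_pmf.expectation P (\<lambda>k. real k * f k) / measure_pmf.expectation P real"
proof -
  have "measure_pmf.expectation (size_bias P) f
      = (\<integral>k. pmf (size_bias P) k * f k \<partial>count_space UNIV)"
    unfolding measure_pmf_eq_density by (subst integral_density) auto
  also have "\<dots> = (\<integral>k. pmf P k * (real k * f k / measure_pmf.expectation P real) \<partial>count_space UNIV)"
    by (simp add: pmf_size_bias[OF int pos] field_simps)
  also have "\<dots> = measure_pmf.expectation P (\<lambda>k. real k * f k / measure_pmf.expectation P real)"
    unfolding measure_pmf_eq_density[of P] by (subst integral_density) auto
  finally show ?thesis by simp
qed

text \<open>The characterisation of the equilibrium law that Stein's method needs: the urn turns the difference
  operator into evaluation at its time parameter, and the size bias turns \<open>f\<close> into \<open>k * f k\<close>. Only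
  the difference is required to be bounded, because this is what is integrated over the urn.\<close>

lemma equilibrium_identity:
  fixes f :: "nat \<Rightarrow> real"
  assumes r: "r > 0"
    and int: "integrable (measure_pmf P) real" and pos: "measure_pmf.expectation P real > 0"
    and bdd: "\<And>u. \<bar>(r + real u) * f (Suc u) - real u * f u\<bar> \<le> C"
  shows "measure_pmf.expectation (equilibrium r P) (\<lambda>u. (r + real u) * f (Suc u) - real u * f u)
       = r * measure_pmf.expectation P (\<lambda>k. real k * f k) / measure_pmf.expectation P real"
proof -
  let ?D = "\<lambda>u. (r + real u) * f (Suc u) - real u * f u"
  have "measure_pmf.expectation (equilibrium r P) ?D
      = measure_pmf.expectation (size_bias P) (\<lambda>n. measure_pmf.expectation (polya_urn r n) ?D)"
    unfolding equilibrium_def by (rule expectation_bind_pmf_bounded[OF bdd])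
  also have "\<dots> = measure_pmf.expectation P
      (\<lambda>n. real n * measure_pmf.expectation (polya_urn r n) ?D) / measure_pmf.expectation P real"
    by (rule expectation_size_bias[OF int pos])
  also have "(\<lambda>n. real n * measure_pmf.expectation (polya_urn r n) ?D) = (\<lambda>n. r * (real n * f n))"
  proof
    fix n show "real n * measure_pmf.expectation (polya_urn r n) ?D = r * (real n * f n)"
      using polya_urn_telescope[OF r, of n f] by (cases "n = 0") auto
  qed
  finally show ?thesis by simp
qed

section \<open>Weights and tails of the negative binomial law\<close>

locale neg_binomial =
  fixes r p :: real
  assumes r: "0 < r" and p_pos: "0 < p" and p_less: "p < 1"
begin

definition w :: "nat \<Rightarrow> real" where
  "w k = pmf (NB r p) k"

definition ratio :: "nat \<Rightarrow> real" where
  "ratio k = (1 - p) * (r + real k) / (real k + 1)"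

definition low :: "nat set \<Rightarrow> nat \<Rightarrow> real" where
  "low A k = measure_pmf.prob (NB r p) (A \<inter> {..<k})"

definition upp :: "nat set \<Rightarrow> nat \<Rightarrow> real" where
  "upp A k = measure_pmf.prob (NB r p) (A \<inter> {k..})"

lemma w_pos: "w k > 0"
  using r p_pos p_less Gamma_real_pos[of r] Gamma_real_pos[of "r + real k"]
  by (simp add: w_def pmf_NB)

lemma w_nonneg: "w k \<ge> 0"
  using w_pos[of k] by simp

lemma w_0: "w 0 = p powr r"
proof -
  have "Gamma r \<noteq> 0" using Gamma_real_pos[OF r] by linarith
  then show ?thesis using r p_pos p_less by (simp add: w_def pmf_NB)
qed

lemma w_Suc: "w (Suc k) = ratio k * w k"
proof -
  have "r + real k \<noteq> 0" using r by simp
  then have "Gamma (r + real k + 1) = (r + real k) * Gamma (r + real k)"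
    using r by (intro Gamma_plus1) (auto elim!: nonpos_Ints_cases)
  then show ?thesis
    using r p_pos p_less Gamma_real_pos[OF r]
    by (simp add: w_def pmf_NB ratio_def add_ac mult_ac)
qed

lemma ratio_pos: "ratio k > 0"
  using r p_less by (simp add: ratio_def)

lemma Suc_w_Suc: "real (Suc k) * w (Suc k) = (1 - p) * (r + real k) * w k"
  by (simp add: w_Suc ratio_def field_simps)

lemma low_0 [simp]: "low A 0 = 0"
  by (simp add: low_def)

lemma low_Suc: "low A (Suc k) = low A k + indicator A k * w k"
proof -
  have "A \<inter> {..<Suc k} = (A \<inter> {..<k}) \<union> (A \<inter> {k})" by (auto simp: less_Suc_eq)
  then have "low A (Suc k) = low A k + measure_pmf.prob (NB r p) (A \<inter> {k})"
    unfolding low_def by (simp only:) (rule measure_pmf.finite_measure_Union; auto)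
  then show ?thesis
    by (auto simp: w_def measure_pmf_single indicator_def Int_insert_right)
qed

lemma low_plus_upp: "low A k + upp A k = measure_pmf.prob (NB r p) A"
proof -
  have "A = (A \<inter> {..<k}) \<union> (A \<inter> {k..})" by auto
  then show ?thesis
    unfolding low_def upp_def
    by (subst measure_pmf.finite_measure_Union[symmetric]) (auto intro!: arg_cong[where f = "measure_pmf.prob (NB r p)"])
qed

lemma upp_Suc: "upp A k = indicator A k * w k + upp A (Suc k)"
  using low_plus_upp[of A k] low_plus_upp[of A "Suc k"] low_Suc[of A k] by simp

lemma low_nonneg: "low A k \<ge> 0" and upp_nonneg: "upp A k \<ge> 0"
  by (simp_all add: low_def upp_def)

lemma low_le: "low A k \<le> low UNIV k" and upp_le: "upp A k \<le> upp UNIV k"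
  unfolding low_def upp_def by (rule measure_pmf.finite_measure_mono; auto)+

lemma low_plus_upp_UNIV: "low UNIV k + upp UNIV k = 1"
  by (simp add: low_plus_upp)

lemma low_UNIV_eq: "low UNIV k = (\<Sum>j<k. w j)"
  by (induction k) (simp_all add: low_Suc)

lemma low_Compl: "low (- A) k = low UNIV k - low A k"
  by (induction k) (auto simp: low_Suc indicator_def algebra_simps)

lemma upp_Compl: "upp (- A) k = upp UNIV k - upp A k"
  using low_plus_upp[of A k] low_plus_upp[of "- A" k] low_plus_upp_UNIV[of k] low_Compl[of A k]
    measure_pmf.prob_compl[of A "NB r p"] by (simp add: Compl_eq_Diff_UNIV)

lemma upp_sums: "(\<lambda>i. w (i + k)) sums upp UNIV k"
proof -
  have "(\<lambda>i. measure_pmf.prob (NB r p) {i}) sums measure_pmf.prob (NB r p) (\<Union>i. {i})"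
    by (rule measure_pmf.finite_measure_UNION) (auto simp: disjoint_family_on_def)
  then have "w sums 1"
    by (simp add: w_def[abs_def] measure_pmf_single)
  then have "(\<lambda>i. w (i + k)) sums (1 - (\<Sum>j<k. w j))"
    by (simp add: sums_iff_shift)
  then show ?thesis
    using low_plus_upp_UNIV[of k] by (metis add_diff_cancel_left' low_UNIV_eq)
qed

text \<open>The ratio is \<open>(1 - p) * (1 + (r - 1) / (k + 1))\<close>: the weights are log-concave for \<open>r \<ge> 1\<close>, while
  for \<open>r \<le> 1\<close> they decay at least as fast as a geometric sequence. All tail comparisons below come from
  this dichotomy.\<close>

lemma ratio_antimono: "1 \<le> r \<Longrightarrow> j \<le> k \<Longrightarrow> ratio k \<le> ratio j"
proof -
  assume "1 \<le> r" and jk: "j \<le> k"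
  then have "(r - 1) / (real k + 1) \<le> (r - 1) / (real j + 1)"
    by (intro divide_left_mono) auto
  then have "(1 - p) * (1 + (r - 1) / (real k + 1)) \<le> (1 - p) * (1 + (r - 1) / (real j + 1))"
    using p_less by (intro mult_left_mono) auto
  then show ?thesis by (simp add: ratio_def divide_simps add_ac)
qed

lemma ratio_le: "r \<le> 1 \<Longrightarrow> ratio k \<le> 1 - p"
  using p_less by (simp add: ratio_def divide_simps)

lemma upp_Suc_le_ratio: 
  assumes "1 \<le> r" shows "upp UNIV (Suc k) \<le> ratio k * upp UNIV k"
proof (rule sums_le)
  show "(\<lambda>i. w (i + Suc k)) sums upp UNIV (Suc k)" by (rule upp_sums)
  show "(\<lambda>i. ratio k * w (i + k)) sums (ratio k * upp UNIV k)"
    by (intro sums_mult upp_sums)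
  show "w (i + Suc k) \<le> ratio k * w (i + k)" for i
    using ratio_antimono[OF assms, of k "i + k"] w_pos[of "i + k"] by (simp add: w_Suc)
qed

lemma upp_le_geometric:
  assumes "r \<le> 1" shows "p * upp UNIV k \<le> w k"
proof -
  have "upp UNIV (Suc k) \<le> (1 - p) * upp UNIV k"
  proof (rule sums_le)
    show "(\<lambda>i. w (i + Suc k)) sums upp UNIV (Suc k)" by (rule upp_sums)
    show "(\<lambda>i. (1 - p) * w (i + k)) sums ((1 - p) * upp UNIV k)"
      by (intro sums_mult upp_sums)
    show "w (i + Suc k) \<le> (1 - p) * w (i + k)" for i
      using ratio_le[OF assms, of "i + k"] w_pos[of "i + k"] by (simp add: w_Suc)
  qed
  then show ?thesis using upp_Suc[of UNIV k] by (simp add: algebra_simps)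
qed

lemma ratio_low_le:
  assumes "1 \<le> r" shows "ratio k * low UNIV k \<le> low UNIV (Suc k) - w 0"
proof -
  have "ratio k * low UNIV k = (\<Sum>j<k. ratio k * w j)"
    by (simp add: low_UNIV_eq sum_distrib_left)
  also have "\<dots> \<le> (\<Sum>j<k. w (Suc j))"
    by (intro sum_mono) (auto simp: w_Suc w_nonneg intro!: mult_right_mono ratio_antimono[OF assms])
  also have "\<dots> = low UNIV (Suc k) - w 0"
    unfolding low_UNIV_eq by (subst sum.lessThan_Suc_shift) simp
  finally show ?thesis .
qed

lemma w_0_le_low: "w 0 \<le> low UNIV (Suc k)"
  unfolding low_UNIV_eq by (subst sum.lessThan_Suc_shift) (simp add: sum_nonneg w_nonneg)

lemma ratio_low_le_low_Suc: "ratio k * low UNIV k \<le> low UNIV (Suc k)"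
proof (cases "1 \<le> r")
  case True
  then show ?thesis using ratio_low_le[of k] w_pos[of 0] by simp
next
  case False
  then have "ratio k \<le> 1" using ratio_le[of k] p_pos by simp
  then have "ratio k * low UNIV k \<le> 1 * low UNIV k"
    by (intro mult_right_mono low_nonneg)
  then show ?thesis using w_pos[of k] by (simp add: low_Suc)
qed

section \<open>The Stein equation\<close>

text \<open>\<open>stein A k\<close> is \<open>k * f k\<close> for the bounded solution \<open>f\<close> of the Stein equation. Multiplied by
  \<open>w k\<close>, that equation telescopes, so \<open>k * w k * f k\<close> is the sum of
  \<open>w j * (indicator A j - \<pi> A)\<close> over \<open>j < k\<close>; the numerator below is that sum in a form which is
  antisymmetric in the two sides of \<open>k\<close>. The factor \<open>k\<close> stays in because the equation does
  not determine \<open>f 0\<close>.\<close>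

definition stein :: "nat set \<Rightarrow> nat \<Rightarrow> real" where
  "stein A k = (low A k * upp UNIV k - upp A k * low UNIV k) / w k"

text \<open>This is \<open>g\<close> of the introduction, with the Stein equation already used to remove the shift;
  \<open>flux_eq\<close> recovers the form as a difference operator.\<close>

definition flux :: "nat set \<Rightarrow> nat \<Rightarrow> real" where
  "flux A k = indicator A k - measure_pmf.prob (NB r p) A + p * stein A k"

lemma flux_eq:
  "flux A k = (1 - p) * ((r + real k) * (stein A (Suc k) / real (Suc k)) - stein A k)"
proof -
  have "(1 - p) * ((r + real k) * (stein A (Suc k) / real (Suc k)))
      = ratio k * stein A (Suc k)"
    by (simp add: ratio_def add_ac)
  also have "\<dots> = (low A (Suc k) * upp UNIV (Suc k) - upp A (Suc k) * low UNIV (Suc k)) / w k"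
    using ratio_pos[of k] w_pos[of k] by (simp add: stein_def w_Suc)
  also have "\<dots> = stein A k + indicator A k - measure_pmf.prob (NB r p) A"
  proof -
    have U: "upp UNIV (Suc k) = 1 - low UNIV k - w k"
      using low_plus_upp_UNIV[of k] upp_Suc[of UNIV k] by simp
    have U': "upp UNIV k = 1 - low UNIV k"
      using low_plus_upp_UNIV[of k] by simp
    have u: "upp A (Suc k) = measure_pmf.prob (NB r p) A - low A k - indicator A k * w k"
      "upp A k = measure_pmf.prob (NB r p) A - low A k"
      using low_plus_upp[of A k] upp_Suc[of A k] by simp_all
    show ?thesis
      unfolding stein_def low_Suc U U' u using w_pos[of k] by (simp add: field_simps)
  qed
  finally show ?thesis by (simp add: flux_def algebra_simps)
qed

lemma stein_Compl: "stein (- A) k = - stein A k"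
  unfolding stein_def low_Compl upp_Compl minus_divide_left
  by (simp add: algebra_simps)

lemma flux_Compl: "flux (- A) k = - flux A k"
  using measure_pmf.prob_compl[of A "NB r p"]
  by (auto simp: flux_def stein_Compl indicator_def simp flip: Compl_eq_Diff_UNIV)

section \<open>Size of the Stein solution\<close>

text \<open>The recursion of the weights reads
  \<open>(j + 1) * w (j + 1) - j * w j = ((1 - p) * r - p * j) * w j\<close>, and \<open>(1 - p) * r - p * j\<close> is \<open>p\<close> times the
  distance of \<open>j\<close> from the mean of \<open>NB r p\<close>.\<close>

lemma real_mult_w_eq_sum: "real k * w k = (\<Sum>j<k. ((1 - p) * r - p * real j) * w j)"
proof (induction k)
  case (Suc k)
  then show ?case using Suc_w_Suc[of k] by (simp add: algebra_simps)
qed simp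

lemma sum_gap_eq_sum_low: "(\<Sum>j<k. (real k - real j) * w j) = (\<Sum>j<k. low UNIV (Suc j))"
proof (induction k)
  case (Suc k)
  have "(\<Sum>j<Suc k. (real (Suc k) - real j) * w j)
      = (\<Sum>j<Suc k. (real k - real j) * w j) + (\<Sum>j<Suc k. w j)"
    by (simp add: algebra_simps flip: sum.distrib)
  then show ?case using Suc by (simp add: low_UNIV_eq)
qed simp

text \<open>The mean of \<open>NB r p\<close> conditioned to \<open>{..<k}\<close> stays at least \<open>k / (r + 1)\<close> below \<open>k\<close>. In the induction,
  the new term costs \<open>k * w k\<close>, which is at most \<open>r * low UNIV k\<close> because the summands of
  \<open>real_mult_w_eq_sum\<close> are at most \<open>r * w j\<close>.\<close>

lemma real_mult_low_le_gap: "real k * low UNIV k \<le> (r + 1) * (\<Sum>j<k. (real k - real j) * w j)"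
  unfolding sum_gap_eq_sum_low
proof (induction k)
  case (Suc k)
  have "real k * w k \<le> (\<Sum>j<k. (1 - p) * r * w j)"
    unfolding real_mult_w_eq_sum using p_pos
    by (intro sum_mono mult_right_mono) (auto simp: w_nonneg)
  also have "\<dots> = (1 - p) * r * low UNIV k"
    by (simp add: low_UNIV_eq sum_distrib_left)
  also have "\<dots> \<le> r * low UNIV k"
    using p_pos r low_nonneg[of UNIV k] by (intro mult_right_mono) auto
  finally have "real k * w k \<le> r * low UNIV k" .
  moreover have "low UNIV (Suc k) = low UNIV k + w k" by (simp add: low_Suc)
  moreover have "r * w k \<ge> 0" using r w_nonneg by simp
  ultimately show ?case
    using Suc by (simp add: algebra_simps)
qed simp

text \<open>Telescoping from \<open>k\<close> upwards, every increment of \<open>- j * w j\<close> is at least the drift at \<open>k\<close> times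
  \<open>w j\<close>. The boundary term \<open>(n + k) * w (n + k)\<close> at the far end has the right sign, so its limit does not
  have to be computed.\<close>

lemma drift_mult_upp_le: "(p * real k - (1 - p) * r) * upp UNIV k \<le> real k * w k"
proof (rule LIMSEQ_le_const2)
  have "(\<lambda>n. \<Sum>i<n. w (i + k)) \<longlonglongrightarrow> upp UNIV k"
    using upp_sums by (simp add: sums_def)
  then show "(\<lambda>n. (p * real k - (1 - p) * r) * (\<Sum>i<n. w (i + k)))
      \<longlonglongrightarrow> (p * real k - (1 - p) * r) * upp UNIV k"
    by (rule tendsto_mult_left)
  have partial: "(p * real k - (1 - p) * r) * (\<Sum>i<n. w (i + k)) + real (n + k) * w (n + k)
      \<le> real k * w k" for n
  proof (induction n)
    case (Suc n)
    have "0 \<le> p * real n * w (n + k)"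
      using p_pos w_pos[of "n + k"] by simp
    then show ?case
      using Suc Suc_w_Suc[of "n + k"] by (simp add: algebra_simps)
  qed simp
  then show "\<exists>N. \<forall>n\<ge>N. (p * real k - (1 - p) * r) * (\<Sum>i<n. w (i + k)) \<le> real k * w k"
  proof (intro exI[of _ 0] allI impI)
    fix n
    have "0 \<le> real (n + k) * w (n + k)" using w_pos[of "n + k"] by simp
    then show "(p * real k - (1 - p) * r) * (\<Sum>i<n. w (i + k)) \<le> real k * w k"
      using partial[of n] by linarith
  qed
qed

text \<open>Split \<open>k * w k\<close> according to \<open>L + U = 1\<close>, use the sum above \<open>k\<close> for the part with \<open>L\<close> and the sum below
  \<open>k\<close> for the part with \<open>U\<close>. The mean cancels and \<open>p * U\<close> times the gap of the lower part remains.\<close>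

lemma stein_kernel_bound: "p * (low UNIV k * upp UNIV k) \<le> (r + 1) * w k"
proof (cases "k = 0")
  case True
  then show ?thesis using r w_pos[of 0] by simp
next
  case False
  let ?L = "low UNIV k" and ?U = "upp UNIV k" and ?S = "\<Sum>j<k. (real k - real j) * w j"
  have kw: "real k * w k = (p * ?S - (p * real k - (1 - p) * r) * ?L)"
    unfolding real_mult_w_eq_sum low_UNIV_eq
    by (simp add: sum_distrib_left algebra_simps sum_subtractf sum.distrib)
  have "real k * w k = real k * w k * ?L + real k * w k * ?U"
    using low_plus_upp_UNIV[of k] by (simp flip: distrib_left)
  also have "\<dots> \<ge> (p * real k - (1 - p) * r) * ?U * ?L + real k * w k * ?U"
    using drift_mult_upp_le[of k] low_nonneg[of UNIV k] by (intro add_right_mono mult_right_mono)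
  also have "(p * real k - (1 - p) * r) * ?U * ?L + real k * w k * ?U = p * ?S * ?U"
    unfolding kw by (simp add: algebra_simps)
  finally have "(r + 1) * (p * ?S * ?U) \<le> (r + 1) * (real k * w k)"
    using r by (intro mult_left_mono) auto
  moreover have "p * (real k * ?L) * ?U \<le> p * ((r + 1) * ?S) * ?U"
    using real_mult_low_le_gap[of k] p_pos upp_nonneg[of UNIV k] by (intro mult_right_mono mult_left_mono) auto
  ultimately have "real k * (p * (?L * ?U)) \<le> real k * ((r + 1) * w k)"
    by (simp add: algebra_simps)
  then show ?thesis using False by simp
qed

lemma abs_stein_le: "\<bar>p * stein A k\<bar> \<le> r + 1"
proof -
  let ?P = "low UNIV k * upp UNIV k"
  have "low A k * upp UNIV k \<le> ?P" "upp A k * low UNIV k \<le> ?P"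
    using low_le[of A k] upp_le[of A k] low_nonneg[of UNIV k] upp_nonneg[of UNIV k]
    by (simp_all add: mult.commute[of _ "low UNIV k"] mult_left_mono mult_right_mono)
  moreover have "0 \<le> low A k * upp UNIV k" "0 \<le> upp A k * low UNIV k"
    by (simp_all add: low_nonneg upp_nonneg)
  ultimately have "\<bar>low A k * upp UNIV k - upp A k * low UNIV k\<bar> \<le> ?P" by linarith
  then have "p * \<bar>low A k * upp UNIV k - upp A k * low UNIV k\<bar> \<le> p * ?P"
    using p_pos by (intro mult_left_mono) auto
  also note stein_kernel_bound[of k]
  finally show ?thesis
    using w_pos[of k] p_pos by (simp add: stein_def abs_mult divide_simps)
qed

lemma abs_flux_le: "\<bar>flux A k\<bar> \<le> r + 2"
proof -
  have "\<bar>indicator A k - measure_pmf.prob (NB r p) A\<bar> \<le> 1"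
    using measure_pmf.prob_le_1[of "NB r p" A] by (auto simp: indicator_def)
  then show ?thesis using abs_stein_le[of A k] unfolding flux_def by linarith
qed

section \<open>Increments of the Stein solution\<close>

text \<open>The increment as a linear form in the indicator of \<open>A\<close>, sorted into the points below \<open>k\<close>, the points
  \<open>k\<close> and \<open>k + 1\<close>, and the points beyond. Here \<open>v\<close> is the reciprocal of the hazard rate, and its
  increment decides the sign of the first group.\<close>

lemma flux_diff:
  fixes A k
  defines "v \<equiv> upp UNIV k / w k" and "v' \<equiv> upp UNIV (Suc k) / w (Suc k)"
  shows "flux A (Suc k) - flux A k =
      p * (v' - v) * low A k
      + (p * (w k * v' + low UNIV k) - 1) * indicator A k
      + (1 - p * (low UNIV (Suc k) - ratio k * low UNIV k)) * indicator A (Suc k)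
      - p * (low UNIV (Suc k) - ratio k * low UNIV k) / w (Suc k) * upp A (Suc (Suc k))"
proof -
  let ?L = "low UNIV k"
  have w1: "w (Suc k) > 0" and w0: "w k > 0" by (rule w_pos)+
  have r: "ratio k = w (Suc k) / w k" using w0 by (simp add: w_Suc)
  have u: "upp A k = indicator A k * w k + indicator A (Suc k) * w (Suc k) + upp A (Suc (Suc k))"
    "upp A (Suc k) = indicator A (Suc k) * w (Suc k) + upp A (Suc (Suc k))"
    by (simp_all add: upp_Suc[of A k] upp_Suc[of A "Suc k"])
  have S: "low UNIV (Suc k) = ?L + w k" by (simp add: low_Suc)
  have stein: "stein A (Suc k) - stein A k =
      (v' - v) * low A k + (w k * v' + ?L) * indicator A k
      - (?L + w k - ratio k * ?L) * indicator A (Suc k)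
      - (?L + w k - ratio k * ?L) / w (Suc k) * upp A (Suc (Suc k))"
    unfolding stein_def v_def v'_def u r low_Suc S
    using w1 w0 by (simp add: field_simps)
  have flux: "flux A (Suc k) - flux A k
      = indicator A (Suc k) - indicator A k + p * (stein A (Suc k) - stein A k)"
    by (simp add: flux_def right_diff_distrib)
  show ?thesis
    unfolding flux stein S by (simp add: algebra_simps diff_divide_distrib add_divide_distrib)
qed

text \<open>Only the coefficients with a nonnegative sign contribute. For \<open>r \<ge> 1\<close> this is the one of \<open>k + 1\<close>,
  at most \<open>1 - p * w 0 = 1 - p powr (r + 1)\<close>. For \<open>r < 1\<close> the points below \<open>k\<close> contribute too. There
  \<open>v' \<le> 1 / p\<close> and \<open>v = 1 + ratio k * v' \<ge> 1 + ratio k\<close>, and the two terms with \<open>ratio k\<close> cancel when the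
  contributions are added, which leaves an excess of at most \<open>1 - p\<close> over the previous bound.\<close>

lemma flux_diff_upper:
  "flux A (Suc k) - flux A k \<le> min ((r + 2) * (1 - p)) (2 - p)"
proof -
  define v v' where "v = upp UNIV k / w k" and "v' = upp UNIV (Suc k) / w (Suc k)"
  let ?L = "low UNIV k" and ?s = "low UNIV (Suc k) - ratio k * low UNIV k"
  let ?a = "1 - p * ?s"
  have w0: "w k > 0" and w1: "w (Suc k) > 0" by (rule w_pos)+
  have v_rec: "v = 1 + ratio k * v'"
    unfolding v_def v'_def w_Suc using upp_Suc[of UNIV k] w0 ratio_pos[of k] by (simp add: field_simps)
  have v'_ge: "v' \<ge> 1"
    unfolding v'_def using upp_Suc[of UNIV "Suc k"] upp_nonneg[of UNIV "Suc (Suc k)"] w1 by simp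
  have s0: "?s \<ge> 0" using ratio_low_le_low_Suc[of k] by simp
  have L1: "low UNIV (Suc k) \<le> 1" 
    using low_plus_upp_UNIV[of "Suc k"] upp_nonneg[of UNIV "Suc k"] by simp
  have "?s \<le> 1" using L1 mult_nonneg_nonneg[OF less_imp_le[OF ratio_pos] low_nonneg, of k UNIV k] by linarith
  then have a0: "?a \<ge> 0" using p_pos p_less s0 mult_le_one[of p ?s] by simp
  \<comment> \<open>Bernoulli's inequality for the exponent \<open>r + 1\<close>, as \<open>p * w 0 = p powr (r + 1)\<close>.\<close>
  have bernoulli: "1 - p * w 0 \<le> (r + 1) * (1 - p)"
  proof -
    have "p powr (r + 1) - 1 powr (r + 1) \<ge> (r + 1) * (p - 1)"
    proof (rule convex_on_imp_above_tangent[where A = "{0<..}"])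
      show "convex_on {0<..} (\<lambda>x. x powr (r + 1))"
        using r by (intro powr_convex) auto
      show "((\<lambda>x. x powr (r + 1)) has_field_derivative (r + 1)) (at 1 within {0<..})"
        by (auto intro!: derivative_eq_intros)
    qed (use p_pos in \<open>auto simp: interior_open\<close>)
    then show ?thesis
      using p_pos by (simp add: w_0 powr_add algebra_simps)
  qed
  \<comment> \<open>The point \<open>k\<close> never helps: \<open>v'\<close> is dominated by \<open>v\<close> in the log-concave case and by \<open>1 / p\<close>
    in the geometric case.\<close>
  have b: "p * (w k * v' + ?L) - 1 \<le> 0"
  proof (cases "1 \<le> r")
    case True
    have "v' \<le> v"
      unfolding v_def v'_def w_Suc
      using upp_Suc_le_ratio[OF True, of k] w0 ratio_pos[of k] by (simp add: field_simps)
    then have "w k * v' \<le> upp UNIV k"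
      using w0 mult_left_mono[of v' v "w k"] by (simp add: v_def)
    then have "p * (w k * v' + ?L) \<le> 1 * 1"
      using low_plus_upp_UNIV[of k] p_pos p_less low_nonneg[of UNIV k] w0 v'_ge
      by (intro mult_mono) auto
    then show ?thesis by simp
  next
    case False
    then have "p * v' \<le> 1"
      unfolding v'_def using upp_le_geometric[of "Suc k"] w1 by (simp add: divide_simps)
    then have "p * (w k * v') \<le> w k"
      using w0 mult_left_mono[of "p * v'" 1 "w k"] by (simp add: mult_ac)
    moreover have "p * ?L \<le> ?L"
      using p_less low_nonneg[of UNIV k] by (simp add: mult_left_le_one_le p_pos less_imp_le)
    ultimately show ?thesis using L1 by (simp add: low_Suc algebra_simps)
  qed
  have "flux A (Suc k) - flux A k \<le> p * (v' - v) * low A k + ?a * indicator A (Suc k)"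
  proof -
    have "(p * (w k * v' + ?L) - 1) * indicator A k \<le> 0"
      using b by (intro mult_nonpos_nonneg) auto
    moreover have "0 \<le> p * ?s / w (Suc k) * upp A (Suc (Suc k))"
      using s0 p_pos w1 upp_nonneg by (intro mult_nonneg_nonneg divide_nonneg_nonneg) auto
    ultimately show ?thesis
      unfolding flux_diff v_def v'_def by linarith
  qed
  also have "\<dots> \<le> p * (v' - v) * low A k + ?a"
    using a0 by (auto simp: indicator_def)
  also have "\<dots> \<le> min ((r + 2) * (1 - p)) (2 - p)"
  proof (cases "1 \<le> r")
    case True
    have "v' \<le> v"
      unfolding v_def v'_def w_Suc
      using upp_Suc_le_ratio[OF True, of k] w0 ratio_pos[of k] by (simp add: field_simps)
    then have "p * (v' - v) * low A k \<le> 0"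
      using p_pos low_nonneg[of A k] by (intro mult_nonpos_nonneg mult_nonneg_nonpos) auto
    moreover have "p * w 0 \<le> p * ?s"
      using ratio_low_le[OF True, of k] p_pos by (intro mult_left_mono) auto
    moreover have "p * w 0 \<ge> 0" using p_pos w_pos[of 0] by simp
    moreover have "(r + 1) * (1 - p) \<le> (r + 2) * (1 - p)" using p_less by (intro mult_right_mono) auto
    ultimately show ?thesis using bernoulli p_less by (intro min.boundedI) linarith+
  next
    case False
    then have pv': "p * v' \<le> 1"
      unfolding v'_def using upp_le_geometric[of "Suc k"] w1 by (simp add: divide_simps)
    have "ratio k * v' \<ge> ratio k" using v'_ge ratio_pos[of k] by simp
    then have "p * (1 + ratio k) \<le> p * v"
      unfolding v_rec using p_pos by (intro mult_left_mono) auto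
    then have al: "p * (v' - v) \<le> 1 - p - p * ratio k"
      using pv' by (simp add: algebra_simps)
    have "ratio k \<le> 1 - p" using ratio_le False by simp
    then have "p * ratio k \<le> 1 * (1 - p)"
      using p_pos p_less ratio_pos[of k] by (intro mult_mono) auto
    then have al0: "0 \<le> 1 - p - p * ratio k" by simp
    have "p * (v' - v) * low A k \<le> (1 - p - p * ratio k) * ?L"
      using al al0 low_le[of A k] low_nonneg[of A k] by (intro mult_mono) auto
    then have *: "p * (v' - v) * low A k + ?a \<le> 1 - p * low UNIV (Suc k) + (1 - p) * ?L"
      by (simp add: algebra_simps)
    have "?L \<le> 1" using L1 w0 by (simp add: low_Suc)
    then have "(1 - p) * ?L \<le> 1 - p" using p_less by (simp add: mult_left_le)
    moreover have "p * low UNIV (Suc k) \<ge> p * w 0"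
      using w_0_le_low p_pos by simp
    moreover have "p * w 0 \<ge> 0" using p_pos w_pos[of 0] by simp
    moreover have "(r + 2) * (1 - p) = (r + 1) * (1 - p) + (1 - p)" by (simp add: algebra_simps)
    ultimately show ?thesis using * bernoulli by (intro min.boundedI) linarith+
  qed
  finally show ?thesis .
qed

lemma flux_lipschitz:
  "\<bar>flux A m - flux A n\<bar> \<le> min ((r + 2) * (1 - p)) (2 - p) * \<bar>real m - real n\<bar>"
proof -
  define c where "c = min ((r + 2) * (1 - p)) (2 - p)"
  \<comment> \<open>The complement of \<open>A\<close> gives the reverse inequality.\<close>
  have step: "\<bar>flux A (Suc k) - flux A k\<bar> \<le> c" for k
    using flux_diff_upper[of A k] flux_diff_upper[of "- A" k] unfolding flux_Compl c_def by linarith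
  have shift: "\<bar>flux A (k + d) - flux A k\<bar> \<le> c * real d" for k d
  proof (induction d)
    case (Suc d)
    have "c * real (Suc d) = c * real d + c" by (simp add: algebra_simps)
    then show ?case using Suc step[of "k + d"] by simp
  qed simp
  have "\<bar>flux A m - flux A n\<bar> \<le> c * \<bar>real m - real n\<bar>"
  proof (cases "n \<le> m")
    case True
    then show ?thesis using shift[of n "m - n"] by simp
  next
    case False
    then show ?thesis using shift[of m "n - m"] by (simp add: abs_minus_commute)
  qed
  then show ?thesis by (simp only: c_def)
qed

section \<open>Comparison of a law with its equilibrium\<close>

text \<open>With \<open>p = r / (r + \<mu>)\<close> the constants match: \<open>(1 - p) * r / \<mu> = p\<close>, so the expectation of
  \<open>flux A\<close> under the equilibrium law is exactly the term \<open>p * stein A\<close> in the definition of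
  \<open>flux\<close>, and what is left under \<open>P\<close> is the Stein equation.\<close>

lemma prob_diff_eq_flux_diff:
  assumes int: "integrable (measure_pmf P) real" and mean: "measure_pmf.expectation P real = \<mu>"
    and \<mu>: "\<mu> > 0" and p: "p = r / (r + \<mu>)"
  shows "measure_pmf.prob P A - measure_pmf.prob (NB r p) A
       = measure_pmf.expectation P (flux A) - measure_pmf.expectation (equilibrium r P) (flux A)"
proof -
  let ?f = "\<lambda>k. stein A k / real k"
  \<comment> \<open>The quotient has the value \<open>0\<close> at \<open>k = 0\<close>, in accordance with \<open>stein A 0 = 0\<close>.\<close>
  have f: "real k * ?f k = stein A k" for k
    by (cases "k = 0") (simp_all add: stein_def)
  have flux: "flux A u = (1 - p) * ((r + real u) * ?f (Suc u) - real u * ?f u)" for u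
    unfolding f flux_eq ..
  have bdd: "\<bar>(r + real u) * ?f (Suc u) - real u * ?f u\<bar> \<le> (r + 2) / (1 - p)" for u
    using abs_flux_le[of A u] p_less unfolding flux by (simp add: abs_mult pos_le_divide_eq mult.commute)
  have "measure_pmf.expectation P real > 0" using mean \<mu> by simp
  from equilibrium_identity[OF r int this bdd]
  have "measure_pmf.expectation (equilibrium r P) (\<lambda>u. (r + real u) * ?f (Suc u) - real u * ?f u)
      = r * measure_pmf.expectation P (stein A) / \<mu>"
    by (simp only: f mean)
  then have "measure_pmf.expectation (equilibrium r P) (flux A)
      = (1 - p) * (r * measure_pmf.expectation P (stein A) / \<mu>)"
    unfolding flux[abs_def] by (simp only: integral_mult_right_zero)
  also have "\<dots> = ((1 - p) * r / \<mu>) * measure_pmf.expectation P (stein A)"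
    by simp
  also have "(1 - p) * r / \<mu> = p"
  proof -
    have "1 - p = \<mu> / (r + \<mu>)"
      using \<mu> r unfolding p by (simp add: divide_simps)
    then show ?thesis using \<mu> by (simp add: p)
  qed
  finally have eq: "measure_pmf.expectation (equilibrium r P) (flux A)
      = p * measure_pmf.expectation P (stein A)" .
  have stein_int: "integrable (measure_pmf P) (stein A)"
    using abs_stein_le[of A] p_pos
    by (intro measure_pmf.integrable_const_bound[where B = "(r + 1) / p"])
      (auto simp: abs_mult pos_le_divide_eq mult.commute)
  have "measure_pmf.expectation P (flux A)
      = measure_pmf.prob P A - measure_pmf.prob (NB r p) A + p * measure_pmf.expectation P (stein A)"
    unfolding flux_def using stein_int by (simp add: measure_pmf.emeasure_eq_measure)
  then show ?thesis unfolding eq by simp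
qed

end

text \<open>Stated for extended reals because the first-moment bound of the theorem may be infinite.\<close>

lemma total_variation_leI:
  assumes "\<And>A. ennreal \<bar>measure_pmf.prob P A - measure_pmf.prob Q A\<bar> \<le> b"
  shows "ennreal (total_variation P Q) \<le> b"
proof (cases b)
  case (real x)
  then have "total_variation P Q \<le> x"
    using assms unfolding total_variation_def by (intro cSUP_least) auto
  then show ?thesis unfolding real by (rule ennreal_leI)
qed simp

theorem theorem1p5:
  fixes M :: "'a measure" and W W' :: "'a \<Rightarrow> nat" and r \<mu> p c :: real
  assumes "prob_space M"
    and "W \<in> measurable M (count_space UNIV)"
    and "W' \<in> measurable M (count_space UNIV)"
    and "integrable M (\<lambda>\<omega>. real (W \<omega>))"
    and "(\<integral>\<omega>. real (W \<omega>) \<partial>M) = \<mu>"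
    and "0 < \<mu>"
    and "0 < r"
    and "law M W' = equilibrium r (law M W)"
    and "p = r / (r + \<mu>)"
    and "c = min ((r + 2) * (1 - p)) (2 - p)"
  shows "c \<le> 2 \<and>
    (\<forall>B\<in>sets M.
      ennreal (total_variation (law M W) (NB r p))
        \<le> ennreal c * (\<integral>\<^sup>+\<omega>. indicator B \<omega> * ennreal \<bar>real (W' \<omega>) - real (W \<omega>)\<bar> \<partial>M)
          + ennreal (2 * (exp 1 * max 1 r + 1) * measure M (space M - B))) \<and>
    total_variation (law M W) (NB r p)
      \<le> 2 * (exp 1 * max 1 r + 1) * measure M {\<omega> \<in> space M. W' \<omega> \<noteq> W \<omega>}"
proof -
  interpret prob_space M by fact
  note [measurable] = assms(2,3)
  let ?P = "law M W" and ?K = "exp 1 * max 1 r + 1"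
  have p: "0 < p" "p < 1" using assms(6,7) by (simp_all add: assms(9))
  interpret neg_binomial r p using assms(7) p by unfold_locales
  have expectation_law: "measure_pmf.expectation (law M X) f = (\<integral>\<omega>. f (X \<omega>) \<partial>M)"
    if "X \<in> measurable M (count_space UNIV)" for X and f :: "nat \<Rightarrow> real"
    unfolding measure_pmf_law[OF assms(1) that] by (rule integral_distr) (use that in auto)
  have int: "integrable (measure_pmf ?P) real"
    unfolding measure_pmf_law[OF assms(1,2)] using assms(4) by (simp add: integrable_distr_eq)
  have mean: "measure_pmf.expectation ?P real = \<mu>"
    using expectation_law[OF assms(2)] assms(5) by simp
  have c: "0 \<le> c" "c \<le> 2"
    using p assms(7) by (simp_all add: assms(10))
  have K: "\<bar>flux A k\<bar> \<le> ?K" for A k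
  proof -
    have "2 * max 1 r \<le> exp 1 * max 1 r"
      using exp_ge_add_one_self[of 1] by (intro mult_right_mono) auto
    then show ?thesis using abs_flux_le[of A k] by linarith
  qed
  have bound: "ennreal (total_variation ?P (NB r p))
        \<le> ennreal c * (\<integral>\<^sup>+\<omega>. indicator B \<omega> * ennreal \<bar>real (W' \<omega>) - real (W \<omega>)\<bar> \<partial>M)
          + ennreal (2 * ?K * measure M (space M - B))" if [measurable]: "B \<in> sets M" for B
  proof (rule total_variation_leI)
    fix A
    have flux_int: "integrable M (\<lambda>\<omega>. flux A (X \<omega>))" if "X \<in> measurable M (count_space UNIV)" for X
      by (intro integrable_const_bound[where B = ?K]) (use K that in auto)
    have "measure_pmf.prob ?P A - measure_pmf.prob (NB r p) A
        = (\<integral>\<omega>. flux A (W \<omega>) - flux A (W' \<omega>) \<partial>M)"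
      using prob_diff_eq_flux_diff[OF int mean assms(6,9), of A]
      by (simp add: expectation_law flux_int assms(2,3) flip: assms(8))
    then have "ennreal \<bar>measure_pmf.prob ?P A - measure_pmf.prob (NB r p) A\<bar>
        \<le> (\<integral>\<^sup>+\<omega>. ennreal \<bar>flux A (W \<omega>) - flux A (W' \<omega>)\<bar> \<partial>M)"
      using integral_norm_bound_ennreal[of M "\<lambda>\<omega>. flux A (W \<omega>) - flux A (W' \<omega>)"]
      by (simp add: flux_int assms(2,3))
    also have "\<dots> \<le> (\<integral>\<^sup>+\<omega>. ennreal c * (indicator B \<omega> * ennreal \<bar>real (W' \<omega>) - real (W \<omega>)\<bar>)
        + ennreal (2 * ?K) * indicator (space M - B) \<omega> \<partial>M)"
    proof (rule nn_integral_mono)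
      fix \<omega> assume \<omega>: "\<omega> \<in> space M"
      have "\<bar>flux A (W \<omega>) - flux A (W' \<omega>)\<bar> \<le> c * \<bar>real (W' \<omega>) - real (W \<omega>)\<bar>"
        using flux_lipschitz[of A "W \<omega>" "W' \<omega>"] unfolding assms(10) by (simp add: abs_minus_commute)
      then have lipschitz: "ennreal \<bar>flux A (W \<omega>) - flux A (W' \<omega>)\<bar>
          \<le> ennreal c * ennreal \<bar>real (W' \<omega>) - real (W \<omega>)\<bar>"
        using c by (simp add: ennreal_leI flip: ennreal_mult)
      have "\<bar>flux A (W \<omega>) - flux A (W' \<omega>)\<bar> \<le> 2 * ?K"
        unfolding mult_2 by (rule order_trans[OF abs_triangle_ineq4 add_mono[OF K K]])
      then have "ennreal \<bar>flux A (W \<omega>) - flux A (W' \<omega>)\<bar> \<le> ennreal (2 * ?K)"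
        by (rule ennreal_leI)
      with lipschitz show "ennreal \<bar>flux A (W \<omega>) - flux A (W' \<omega>)\<bar>
          \<le> ennreal c * (indicator B \<omega> * ennreal \<bar>real (W' \<omega>) - real (W \<omega>)\<bar>)
            + ennreal (2 * ?K) * indicator (space M - B) \<omega>"
        using \<omega> by (cases "\<omega> \<in> B") (simp_all del: ennreal_plus)
    qed
    also have "\<dots> = ennreal c * (\<integral>\<^sup>+\<omega>. indicator B \<omega> * ennreal \<bar>real (W' \<omega>) - real (W \<omega>)\<bar> \<partial>M)
        + ennreal (2 * ?K) * emeasure M (space M - B)"
      by (subst nn_integral_add) (auto simp: nn_integral_cmult)
    also have "ennreal (2 * ?K) * emeasure M (space M - B)
        = ennreal (2 * ?K * measure M (space M - B))"
      by (simp add: emeasure_eq_measure ennreal_mult add_nonneg_nonneg)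
    finally show "ennreal \<bar>measure_pmf.prob ?P A - measure_pmf.prob (NB r p) A\<bar>
        \<le> ennreal c * (\<integral>\<^sup>+\<omega>. indicator B \<omega> * ennreal \<bar>real (W' \<omega>) - real (W \<omega>)\<bar> \<partial>M)
          + ennreal (2 * ?K * measure M (space M - B))" .
  qed
  \<comment> \<open>On the event \<open>W' = W\<close> the integrand vanishes, so the second claim is the first one for this event.\<close>
  have "total_variation ?P (NB r p) \<le> 2 * ?K * measure M {\<omega> \<in> space M. W' \<omega> \<noteq> W \<omega>}"
  proof -
    let ?B = "{\<omega> \<in> space M. W' \<omega> = W \<omega>}"
    have "{\<omega> \<in> space M. real (W' \<omega>) = real (W \<omega>)} \<in> sets M" by measurable
    then have B: "?B \<in> sets M" by simp
    have "(\<integral>\<^sup>+\<omega>. indicator ?B \<omega> * ennreal \<bar>real (W' \<omega>) - real (W \<omega>)\<bar> \<partial>M) = (\<integral>\<^sup>+\<omega>. 0 \<partial>M)"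
      by (intro nn_integral_cong) (auto simp: indicator_def)
    moreover have "space M - ?B = {\<omega> \<in> space M. W' \<omega> \<noteq> W \<omega>}" by auto
    ultimately have "ennreal (total_variation ?P (NB r p))
        \<le> ennreal (2 * ?K * measure M {\<omega> \<in> space M. W' \<omega> \<noteq> W \<omega>})"
      using bound[OF B] by simp
    moreover have "0 \<le> 2 * ?K * measure M {\<omega> \<in> space M. W' \<omega> \<noteq> W \<omega>}"
      by (intro mult_nonneg_nonneg add_nonneg_nonneg) auto
    ultimately show ?thesis by (simp only: ennreal_le_iff)
  qed
  with c bound show ?thesis by blast
qed

end
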